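(* Let $f,g:\mathbb{R}^n\to(-\infty,\infty]$, $F=f+g$, satisfy the standing assumptions listed in the context, with $L$ the Lipschitz constant of $\nabla f$. Assume that the step-size $\gamma>0$ in the proximal gradient (PG) method satisfies $\gamma<\frac1L$. Let the sequence $\{x^k\}_{k=0}^\infty$ be generated by the PG method and let $\bar x$ be an accumulation point of $\{x^k\}_{k=0}^\infty$. Then $\bar x\in\mathcal{X}^\pi$. Suppose in addition that both of the following hold. (a) (PG-iteration-based error bound at $\bar x$) There exist $\kappa,\epsilon>0$ such that $\mathrm{dist}(x^{k+1},\mathcal{X}^\pi)\le\kappa\|x^{k+1}-x^k\|$ for all $k$ such that $x^{k+1}\in\mathbb{B}(\bar x,\epsilon)$. (b) (Proper separation of stationary value at $\bar x$) There exists $\epsilon'>0$ such that $x\in\mathcal{X}^\pi\cap\mathbb{B}(\bar x,\epsilon')$ implies $F(x)=F(\bar x)$. Then the sequence $\{x^k\}_{k=0}^\infty$ converges to $\bar x$ linearly with respect to the sequence of objective function values, i.e., there exist $k_0>0$ and $0<\sigma<1$ such that for all $k\ge k_0$, $$F(x^{k+1})-F(\bar x)\le\sigma\,\bigl(F(x^k)-F(\bar x)\bigr).$$ Moreover, for all $k\ge k_0$, $$\|x^k-\bar x\|\le\rho_0\,\rho^k$$ for some $\rho_0>0$ and $0<\rho<1$.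
   Context: Standing assumptions. $f,g:\mathbb{R}^n\to(-\infty,\infty]$ are proper lower semicontinuous functions, $F:=f+g$, and $\mathrm{dom}\,\phi:=\{x:\phi(x)<\infty\}$. The function $f$ is smooth on $\mathrm{dom} f$, which is assumed to be open, and $\nabla f$ is Lipschitz continuous with constant $L>0$ on a closed set $C\supseteq\mathrm{dom} f\cap\mathrm{dom} g$. The function $g$ is continuous in $\mathrm{dom} g$. $F(x)\ge F_{\min}$ for all $x\in\mathbb{R}^n$. The function $g$ is prox-bounded, meaning that the (possibly set-valued) proximal operator $$\mathrm{Prox}_g^\gamma(a):=\arg\min_{x\in\mathbb{R}^n}\Bigl\{g(x)+\tfrac1{2\gamma}\|x-a\|^2\Bigr\}$$ is well-defined when $\gamma$ is selected with $0<\gamma<\gamma_g$, for a certain $\gamma_g>0$. PG method with step-size $\gamma$: $x^{k+1}\in\mathrm{Prox}_g^\gamma\bigl(x^k-\gamma\nabla f(x^k)\bigr)$ for $k=0,1,2,\dots$ Proximal subdifferential: for $x_0\in\mathrm{dom}\,\phi$, $\partial^\pi\phi(x_0)$ is the set of $\xi$ for which there exist $\sigma,\eta>0$ with $\phi(x)\ge\phi(x_0)+\langle\xi,x-x_0\rangle-\sigma\|x-x_0\|^2$ for all $x\in\mathbb{B}(x_0,\eta)$. $\mathcal{X}^\pi:=\{x: 0\in\nabla f(x)+\partial^\pi g(x)\}$ is the set of proximal stationary points. $\mathbb{B}(x,r)$ is the open ball of radius $r$ centred at $x$.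
   Formalization: The closed set C on which the gradient of f is L-Lipschitz is additionally assumed convex (and contained in dom f); without convexity the claim fails, e.g. PG can cycle forever on the vertices of a regular hexagon. *)

theory Defs
  imports "HOL-Analysis.Analysis"
begin

text \<open>
  Functions with values in the extended interval excluding minus infinity are rendered as
  \<^typ>\<open>ereal\<close>-valued functions that never take the value \<^term>\<open>- \<infinity> :: ereal\<close>; the exclusion is
  part of properness.
\<close>

definition edom :: "('a \<Rightarrow> ereal) \<Rightarrow> 'a set" where
  "edom \<phi> = {x. \<phi> x < \<infinity>}"

definition proper_fun :: "('a \<Rightarrow> ereal) \<Rightarrow> bool" where
  "proper_fun \<phi> \<longleftrightarrow> (\<forall>x. \<phi> x \<noteq> - \<infinity>) \<and> edom \<phi> \<noteq> {}"

definition lsc_fun :: "('a::euclidean_space \<Rightarrow> ereal) \<Rightarrow> bool" where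
  "lsc_fun \<phi> \<longleftrightarrow> (\<forall>x. \<phi> x \<le> Liminf (at x) \<phi>)"

text \<open>
  The gradient is meaningful only at interior points of the domain at which the real part is
  differentiable; it is used only where membership in the (open) domain is also required.
\<close>

definition gradient :: "('a::euclidean_space \<Rightarrow> ereal) \<Rightarrow> 'a \<Rightarrow> 'a" where
  "gradient \<phi> x = (THE D. GDERIV (\<lambda>y. real_of_ereal (\<phi> y)) x :> D)"

text \<open>Smooth means continuously differentiable.\<close>

definition smooth_on_edom :: "('a::euclidean_space \<Rightarrow> ereal) \<Rightarrow> bool" where
  "smooth_on_edom \<phi> \<longleftrightarrow>
     (\<forall>x\<in>edom \<phi>. \<exists>D. GDERIV (\<lambda>y. real_of_ereal (\<phi> y)) x :> D) \<and>
     continuous_on (edom \<phi>) (gradient \<phi>)"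

definition prox :: "('a::euclidean_space \<Rightarrow> ereal) \<Rightarrow> real \<Rightarrow> 'a \<Rightarrow> 'a set" where
  "prox \<phi> \<gamma> a =
     {x. is_arg_min (\<lambda>y. \<phi> y + ereal (1 / (2 * \<gamma>) * (norm (y - a))\<^sup>2)) (\<lambda>_. True) x}"

definition prox_bounded :: "('a::euclidean_space \<Rightarrow> ereal) \<Rightarrow> bool" where
  "prox_bounded \<phi> \<longleftrightarrow> (\<exists>\<gamma>\<^sub>\<phi>>0. \<forall>\<gamma> a. 0 < \<gamma> \<and> \<gamma> < \<gamma>\<^sub>\<phi> \<longrightarrow> prox \<phi> \<gamma> a \<noteq> {})"

text \<open>
  The condition that every iterate lies in the domain of \<open>f\<close> says that the gradient step is
  defined at each iteration; the proximal step alone only guarantees membership in the domain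
  of \<open>g\<close>.
\<close>

definition pg_sequence ::
  "('a::euclidean_space \<Rightarrow> ereal) \<Rightarrow> ('a \<Rightarrow> ereal) \<Rightarrow> real \<Rightarrow> (nat \<Rightarrow> 'a) \<Rightarrow> bool" where
  "pg_sequence f g \<gamma> x \<longleftrightarrow>
     (\<forall>k. x k \<in> edom f \<and> x (Suc k) \<in> prox g \<gamma> (x k - \<gamma> *\<^sub>R gradient f (x k)))"

text \<open>The proximal subdifferential is empty outside the domain.\<close>

definition prox_subdiff :: "('a::euclidean_space \<Rightarrow> ereal) \<Rightarrow> 'a \<Rightarrow> 'a set" where
  "prox_subdiff \<phi> x\<^sub>0 =
     {\<xi>. x\<^sub>0 \<in> edom \<phi> \<and>
          (\<exists>\<sigma>>0. \<exists>\<eta>>0. \<forall>x\<in>ball x\<^sub>0 \<eta>.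
             \<phi> x \<ge> \<phi> x\<^sub>0 + ereal (\<xi> \<bullet> (x - x\<^sub>0) - \<sigma> * (norm (x - x\<^sub>0))\<^sup>2))}"

definition prox_stationary ::
  "('a::euclidean_space \<Rightarrow> ereal) \<Rightarrow> ('a \<Rightarrow> ereal) \<Rightarrow> 'a set" where
  "prox_stationary f g = {x \<in> edom f. 0 \<in> (\<lambda>\<xi>. gradient f x + \<xi>) ` prox_subdiff g x}"

definition accumulation_point :: "(nat \<Rightarrow> 'a::topological_space) \<Rightarrow> 'a \<Rightarrow> bool" where
  "accumulation_point x a \<longleftrightarrow> (\<exists>r::nat \<Rightarrow> nat. strict_mono r \<and> (x \<circ> r) \<longlonglongrightarrow> a)"

text \<open>
  \<^term>\<open>infdist y {} = 0\<close> by library convention. This is harmless below, because the error bound is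
  imposed at a point that is itself proximal stationary.
\<close>

definition pg_error_bound ::
  "('a::euclidean_space \<Rightarrow> ereal) \<Rightarrow> ('a \<Rightarrow> ereal) \<Rightarrow> (nat \<Rightarrow> 'a) \<Rightarrow> 'a \<Rightarrow> bool" where
  "pg_error_bound f g x a \<longleftrightarrow>
     (\<exists>\<kappa>>0. \<exists>\<epsilon>>0. \<forall>k. x (Suc k) \<in> ball a \<epsilon> \<longrightarrow>
        infdist (x (Suc k)) (prox_stationary f g) \<le> \<kappa> * norm (x (Suc k) - x k))"

definition proper_separation ::
  "('a::euclidean_space \<Rightarrow> ereal) \<Rightarrow> ('a \<Rightarrow> ereal) \<Rightarrow> 'a \<Rightarrow> bool" where
  "proper_separation f g a \<longleftrightarrow>
     (\<exists>\<epsilon>>0. \<forall>x \<in> prox_stationary f g \<inter> ball a \<epsilon>. f x + g x = f a + g a)"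

end

theory Submission
  imports Defs
begin

text \<open>
  Comparing the proximal step with its predecessor, together with the quadratic upper bound for \<open>f\<close>
  on the convex set \<open>C\<close>, gives \<open>F (x (k+1)) + a |x (k+1) - x k|\<^sup>2 \<le> F (x k)\<close> with
  \<open>a = 1/(2\<gamma>) - L/2 > 0\<close>; hence the steps tend to zero, and passing to the limit in the proximal
  inequality along a subsequence shows that \<open>xbar\<close> is a fixed point of the step, hence stationary.
  For the rate, compare \<open>x (k+1)\<close> with a nearly closest stationary point: the error bound turns
  this into \<open>F (x (k+1)) - F xbar \<le> c |x (k+1) - x k|\<^sup>2\<close> near \<open>xbar\<close>, so descent contracts the gap
  by \<open>c / (c + a)\<close>. The step lengths are then dominated by a geometric series, so iterates starting
  close enough to \<open>xbar\<close> with a small enough gap never leave the neighbourhood.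
\<close>

text \<open>The Lipschitz bound on \<open>G\<close> makes the derivative of \<open>q\<close> along
  the segment from \<open>u\<close> to \<open>v\<close> nonpositive, and
  \<open>q 1 \<le> q 0\<close> unfolds to the claim. Convexity keeps the segment inside
  \<open>C\<close>.\<close>

lemma quadratic_upper_bound:
  fixes h :: "'a::real_inner \<Rightarrow> real"
  assumes "convex C" and der: "\<And>z. z \<in> C \<Longrightarrow> GDERIV h z :> G z"
    and lip: "L-lipschitz_on C G" and u: "u \<in> C" and v: "v \<in> C"
  shows "h v \<le> h u + G u \<bullet> (v - u) + L / 2 * (norm (v - u))\<^sup>2"
proof -
  define p where "p t = u + t *\<^sub>R (v - u)" for t
  define q where "q t = h (p t) - t * (G u \<bullet> (v - u)) - L / 2 * t\<^sup>2 * (norm (v - u))\<^sup>2" for t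
  have pC: "p t \<in> C" if "0 \<le> t" "t \<le> 1" for t
    using convexD_alt[OF \<open>convex C\<close> u v that] by (simp add: p_def algebra_simps)
  have "\<exists>y. (q has_real_derivative y) (at t) \<and> y \<le> 0" if t: "0 \<le> t" "t \<le> 1" for t
  proof (intro exI conjI)
    have hd: "(h has_derivative (\<lambda>d. d \<bullet> G (p t))) (at (p t))"
      using der[OF pC[OF t]] by (simp add: gderiv_def)
    have pd: "(p has_derivative (\<lambda>s. s *\<^sub>R (v - u))) (at t)"
      unfolding p_def by (auto intro!: derivative_eq_intros)
    have hp: "((\<lambda>t. h (p t)) has_real_derivative G (p t) \<bullet> (v - u)) (at t)"
      using has_derivative_compose[OF pd hd]
      by (simp add: has_field_derivative_def inner_commute mult_commute_abs)
    show "(q has_real_derivative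
        G (p t) \<bullet> (v - u) - G u \<bullet> (v - u) - L * t * (norm (v - u))\<^sup>2) (at t)"
      unfolding q_def by (auto intro!: derivative_eq_intros hp)
    have "(G (p t) - G u) \<bullet> (v - u) \<le> norm (G (p t) - G u) * norm (v - u)"
      by (rule norm_cauchy_schwarz)
    also have "\<dots> \<le> (L * norm (p t - u)) * norm (v - u)"
      using lipschitz_onD[OF lip pC[OF t] u] by (intro mult_right_mono) (auto simp: dist_norm)
    also have "\<dots> = L * t * (norm (v - u))\<^sup>2"
      using t by (simp add: p_def power2_eq_square)
    finally show "G (p t) \<bullet> (v - u) - G u \<bullet> (v - u) - L * t * (norm (v - u))\<^sup>2 \<le> 0"
      by (simp add: inner_diff_left)
  qed
  then have "q 1 \<le> q 0"
    by (intro DERIV_nonpos_imp_nonincreasing[of 0 1 q]) auto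
  then show ?thesis
    by (simp add: q_def p_def)
qed

lemma gradient_GDERIV:
  assumes "smooth_on_edom \<phi>" "z \<in> edom \<phi>"
  shows "GDERIV (\<lambda>y. real_of_ereal (\<phi> y)) z :> gradient \<phi> z"
proof -
  obtain D where D: "GDERIV (\<lambda>y. real_of_ereal (\<phi> y)) z :> D"
    using assms by (auto simp: smooth_on_edom_def)
  have "gradient \<phi> z = D"
    unfolding gradient_def
  proof (rule the_equality)
    show "GDERIV (\<lambda>y. real_of_ereal (\<phi> y)) z :> D" by (rule D)
  next
    fix E assume "GDERIV (\<lambda>y. real_of_ereal (\<phi> y)) z :> E"
    then have "(\<lambda>d. d \<bullet> E) = (\<lambda>d. d \<bullet> D)"
      using D unfolding gderiv_def by (rule has_derivative_unique)
    then show "E = D"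
      by (intro iffD1[OF vector_eq_ldot]) (simp add: fun_eq_iff)
  qed
  then show ?thesis using D by simp
qed

lemma proper_fun_real:
  assumes "proper_fun \<phi>" "z \<in> edom \<phi>"
  shows "\<phi> z = ereal (real_of_ereal (\<phi> z))"
  using assms by (cases "\<phi> z") (auto simp: proper_fun_def edom_def)

text \<open>Only the upper bounds \<open>b\<close> have to converge, which suits inequalities whose
  right-hand side has a known limit.\<close>

lemma lsc_fun_le_lim:
  fixes b :: "nat \<Rightarrow> ereal"
  assumes lsc: "lsc_fun \<phi>" and y: "y \<longlonglongrightarrow> a" and b: "b \<longlonglongrightarrow> B"
    and le: "\<And>j. \<phi> (y j) \<le> b j"
  shows "\<phi> a \<le> B"
proof (rule ccontr)
  assume "\<not> \<phi> a \<le> B"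
  then obtain c where c: "B < c" "c < \<phi> a" by (meson dense not_le)
  then have "c < Liminf (at a) \<phi>"
    using lsc by (auto simp: lsc_fun_def intro: less_le_trans)
  then have "eventually (\<lambda>z. c < \<phi> z) (at a)" by (rule less_LiminfD)
  \<comment> \<open>\<open>lsc_fun\<close> speaks of punctured neighbourhoods;
    \<open>c < \<phi> a\<close> adds the centre, so \<open>y\<close> is allowed to hit
    \<open>a\<close>.\<close>
  with c have "eventually (\<lambda>z. c < \<phi> z) (nhds a)"
    by (simp add: eventually_nhds_conv_at)
  then have "eventually (\<lambda>j. c < \<phi> (y j)) sequentially"
    using y by (rule eventually_compose_filterlim)
  moreover have "eventually (\<lambda>j. b j < c) sequentially"
    using b c(1) by (rule order_tendstoD)
  ultimately have "eventually (\<lambda>j. False) sequentially"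
    by eventually_elim (use le in \<open>meson less_le_not_le less_trans not_le\<close>)
  then show False by simp
qed

lemma prox_in_edom:
  assumes "proper_fun \<phi>" "z \<in> prox \<phi> \<gamma> w"
  shows "z \<in> edom \<phi>"
proof -
  obtain y where y: "\<phi> y < \<infinity>" using assms by (auto simp: proper_fun_def edom_def)
  have "\<not> \<phi> y + ereal (1 / (2 * \<gamma>) * (norm (y - w))\<^sup>2) < \<phi> z + ereal (1 / (2 * \<gamma>) * (norm (z - w))\<^sup>2)"
    using assms by (auto simp: prox_def is_arg_min_def)
  with y show ?thesis by (auto simp: edom_def)
qed

text \<open>Expanding the square around \<open>u - \<gamma> *\<^sub>R D\<close> leaves a term in
  \<open>D\<close> alone, which cancels: a proximal point minimises \<open>\<phi>\<close> plus a
  linear term and a quadratic centred at \<open>u\<close>.\<close>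

lemma prox_gradient_step_le:
  assumes pr: "proper_fun \<phi>" and \<gamma>: "\<gamma> > 0" and z: "z \<in> prox \<phi> \<gamma> (u - \<gamma> *\<^sub>R D)"
  shows "\<phi> z \<le> \<phi> y + ereal (D \<bullet> (y - z) + ((norm (y - u))\<^sup>2 - (norm (z - u))\<^sup>2) / (2 * \<gamma>))"
proof (cases "y \<in> edom \<phi>")
  case False
  then show ?thesis by (simp add: edom_def)
next
  case True
  obtain gy where gy: "\<phi> y = ereal gy" using proper_fun_real[OF pr True] by blast
  obtain gz where gz: "\<phi> z = ereal gz"
    using proper_fun_real[OF pr prox_in_edom[OF pr z]] by blast
  have "\<not> \<phi> y + ereal (1 / (2 * \<gamma>) * (norm (y - (u - \<gamma> *\<^sub>R D)))\<^sup>2) <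
      \<phi> z + ereal (1 / (2 * \<gamma>) * (norm (z - (u - \<gamma> *\<^sub>R D)))\<^sup>2)"
    using z by (auto simp: prox_def is_arg_min_def)
  then have le: "gz + 1 / (2 * \<gamma>) * (norm (z - (u - \<gamma> *\<^sub>R D)))\<^sup>2 \<le>
      gy + 1 / (2 * \<gamma>) * (norm (y - (u - \<gamma> *\<^sub>R D)))\<^sup>2"
    by (simp add: gy gz)
  have ex: "1 / (2 * \<gamma>) * (norm (w - (u - \<gamma> *\<^sub>R D)))\<^sup>2 =
      (norm (w - u))\<^sup>2 / (2 * \<gamma>) + D \<bullet> (w - u) + \<gamma> / 2 * (norm D)\<^sup>2" for w
  proof -
    have "w - (u - \<gamma> *\<^sub>R D) = (w - u) + \<gamma> *\<^sub>R D" by simp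
    then have "(norm (w - (u - \<gamma> *\<^sub>R D)))\<^sup>2 =
        (norm (w - u))\<^sup>2 + 2 * \<gamma> * (D \<bullet> (w - u)) + \<gamma>\<^sup>2 * (norm D)\<^sup>2"
      by (simp only: power2_norm_eq_inner)
        (simp add: inner_add_left inner_add_right inner_commute power2_eq_square algebra_simps)
    then show ?thesis using \<gamma> by (simp add: field_simps power2_eq_square)
  qed
  show ?thesis
    using le unfolding ex gy gz
    by (simp add: inner_diff_right diff_divide_distrib)
qed

text \<open>Moving the linear and quadratic terms to the left makes \<open>- gradient f z\<close> a
  proximal subgradient with constant \<open>1 / (2 * \<gamma>)\<close>. The inequality is global, so
  the radius 1 is arbitrary.\<close>

lemma prox_stationaryI:
  assumes "z \<in> edom f" "z \<in> edom g" "\<gamma> > 0"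
    and "\<And>y. g z \<le> g y + ereal (gradient f z \<bullet> (y - z) + (norm (y - z))\<^sup>2 / (2 * \<gamma>))"
  shows "z \<in> prox_stationary f g"
proof -
  have "g z + ereal (- gradient f z \<bullet> (y - z) - 1 / (2 * \<gamma>) * (norm (y - z))\<^sup>2) \<le> g y" for y
    using assms(4)[of y] by (cases "g z"; cases "g y") auto
  then have "- gradient f z \<in> prox_subdiff g z"
    unfolding prox_subdiff_def
    using assms(2,3) by (intro CollectI conjI exI[of _ "1 / (2 * \<gamma>)"] exI[of _ "1::real"]) auto
  then show ?thesis
    using assms(1) unfolding prox_stationary_def by force
qed

text \<open>Steps are at most the square root of the gap over \<open>a\<close>, so a gap contracting
  by \<open>\<sigma>\<close> gives steps below a geometric series of ratio
  \<open>sqrt \<sigma>\<close>. Contraction is known only when the next iterate is near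
  \<open>xbar\<close>, so it has to be secured inductively.\<close>

lemma local_linear_convergence:
  fixes x :: "nat \<Rightarrow> 'a::real_normed_vector" and \<Phi> :: "nat \<Rightarrow> real"
  assumes a: "a > 0" and \<delta>: "\<delta> > 0" and \<sigma>: "0 < \<sigma>" "\<sigma> < 1"
    and desc: "\<And>k. N \<le> k \<Longrightarrow> \<Phi> (Suc k) + a * (norm (x (Suc k) - x k))\<^sup>2 \<le> \<Phi> k"
    and r: "strict_mono r" and xr: "(x \<circ> r) \<longlonglongrightarrow> xbar" and \<Phi>r: "(\<Phi> \<circ> r) \<longlonglongrightarrow> \<Phi>bar"
    and loc: "\<And>k. N \<le> k \<Longrightarrow> x (Suc k) \<in> ball xbar \<delta> \<Longrightarrow>
      \<Phi> (Suc k) - \<Phi>bar \<le> \<sigma> * (\<Phi> k - \<Phi>bar)"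
  obtains K \<rho>0 \<rho> where "N \<le> K" "\<And>k. K \<le> k \<Longrightarrow> \<Phi> (Suc k) - \<Phi>bar \<le> \<sigma> * (\<Phi> k - \<Phi>bar)"
    "\<rho>0 > 0" "0 < \<rho>" "\<rho> < 1" "\<And>k. K \<le> k \<Longrightarrow> norm (x k - xbar) \<le> \<rho>0 * \<rho> ^ k"
proof -
  define s where "s = sqrt \<sigma>"
  have s: "0 < s" "s < 1" "s\<^sup>2 = \<sigma>" using \<sigma> by (auto simp: s_def)
  have dec: "\<Phi> m \<le> \<Phi> k" if "N \<le> k" "k \<le> m" for k m
    using that(2)
  proof (induction m rule: dec_induct)
    case (step n)
    moreover have "0 \<le> a * (norm (x (Suc n) - x n))\<^sup>2" using a by simp
    ultimately show ?case using desc[of n] that(1) by linarith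
  qed simp
  \<comment> \<open>\<open>\<Phi>\<close> is nonincreasing from \<open>N\<close> on, so a limit
    along a subsequence bounds all these values from below.\<close>
  have low: "\<Phi>bar \<le> \<Phi> k" if "N \<le> k" for k
  proof (rule LIMSEQ_le_const2[OF \<Phi>r], intro exI allI impI)
    fix n assume "k \<le> n"
    then show "(\<Phi> \<circ> r) n \<le> \<Phi> k"
      using dec[OF that] seq_suble[OF r, of n] by (simp add: order_trans)
  qed
  define M where "M k = sqrt ((\<Phi> k - \<Phi>bar) / a)" for k
  have len: "norm (x (Suc k) - x k) \<le> M k" if "N \<le> k" for k
    unfolding M_def using desc[OF that] low[of "Suc k"] that a
    by (intro real_le_rsqrt) (simp add: field_simps)
  \<comment> \<open>The distance to \<open>xbar\<close> plus the bound on the remaining path tends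
    to 0 along the subsequence; this supplies the starting index \<open>K\<close>.\<close>
  have "(\<lambda>j. norm (x (r j) - xbar) + M (r j) / (1 - s)) \<longlonglongrightarrow>
      norm (xbar - xbar) + sqrt ((\<Phi>bar - \<Phi>bar) / a) / (1 - s)"
    unfolding M_def using xr \<Phi>r a s by (intro tendsto_intros) (auto simp: o_def)
  then have "eventually (\<lambda>j. norm (x (r j) - xbar) + M (r j) / (1 - s) < \<delta>) sequentially"
    by (rule order_tendstoD) (use \<delta> in simp)
  then obtain j where j: "N \<le> j" "norm (x (r j) - xbar) + M (r j) / (1 - s) < \<delta>"
    using eventually_happens[OF eventually_conj[OF eventually_ge_at_top[of N]]] by auto
  define K where "K = r j"
  have NK: "N \<le> K" using j(1) seq_suble[OF r, of j] by (simp add: K_def)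
  have M0: "M k \<ge> 0" if "N \<le> k" for k using low[OF that] a by (simp add: M_def)
  have contr: "M (Suc k) \<le> s * M k" if "N \<le> k" "\<Phi> (Suc k) - \<Phi>bar \<le> \<sigma> * (\<Phi> k - \<Phi>bar)" for k
  proof -
    have "M (Suc k) \<le> sqrt (\<sigma> * ((\<Phi> k - \<Phi>bar) / a))"
      unfolding M_def using that(2) a by (simp add: divide_right_mono)
    then show ?thesis unfolding M_def s_def real_sqrt_mult .
  qed
  \<comment> \<open>The remaining path length is at most \<open>M k / (1 - s)\<close>, so distances augmented by it do not grow;
    this confines the iterates to the ball.\<close>
  have pot: "norm (x (Suc k) - c) + s * M k / (1 - s) \<le> norm (x k - c) + M k / (1 - s)"
    if "N \<le> k" for k c
  proof -
    have "norm (x (Suc k) - c) \<le> norm (x (Suc k) - x k) + norm (x k - c)"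
      using norm_triangle_ineq[of "x (Suc k) - x k" "x k - c"] by simp
    moreover have "M k + s * M k / (1 - s) = M k / (1 - s)"
      using s by (simp add: field_simps)
    ultimately show ?thesis using len[OF that] by linarith
  qed
  have contr': "M (Suc k) / (1 - s) \<le> s * M k / (1 - s)"
    if "N \<le> k" "\<Phi> (Suc k) - \<Phi>bar \<le> \<sigma> * (\<Phi> k - \<Phi>bar)" for k
    using contr[OF that] s by (intro divide_right_mono) auto
  \<comment> \<open>No contraction at \<open>k\<close> is used: \<open>pot\<close> alone puts the
    next iterate into the ball, and only then does \<open>loc\<close> apply. This avoids a circular
    induction.\<close>
  have near: "x (Suc k) \<in> ball xbar \<delta>"
    if "N \<le> k" "norm (x k - xbar) + M k / (1 - s) < \<delta>" for k
  proof -
    have "0 \<le> s * M k / (1 - s)" using s M0[OF that(1)] by simp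
    then have "norm (x (Suc k) - xbar) < \<delta>" using pot[OF that(1), of xbar] that(2) by linarith
    then show ?thesis by (simp add: dist_norm norm_minus_commute)
  qed
  have inv: "norm (x k - xbar) + M k / (1 - s) < \<delta>" if "K \<le> k" for k
    using that
  proof (induction k rule: dec_induct)
    case base
    then show ?case using j(2) by (simp add: K_def)
  next
    case (step k)
    have k: "N \<le> k" using step NK by simp
    show ?case
      using contr'[OF k loc[OF k near[OF k step.IH]]] pot[OF k, of xbar] step.IH by linarith
  qed
  have lin: "\<Phi> (Suc k) - \<Phi>bar \<le> \<sigma> * (\<Phi> k - \<Phi>bar)" if "K \<le> k" for k
    using loc near inv[OF that] that NK by simp
  have Mgeo: "M k \<le> M K / s ^ K * s ^ k" if "K \<le> k" for k
    using that
  proof (induction k rule: dec_induct)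
    case base
    then show ?case using s by simp
  next
    case (step k)
    then have "M (Suc k) \<le> s * M k" using contr lin NK by simp
    also have "\<dots> \<le> s * (M K / s ^ K * s ^ k)" using step s by (intro mult_left_mono) auto
    finally show ?case by (simp add: mult_ac)
  qed
  \<comment> \<open>Here \<open>pot\<close> is centred at \<open>x k\<close>; letting
    \<open>m\<close> run along the subsequence then bounds the distance from \<open>x k\<close> to
    \<open>xbar\<close>.\<close>
  have tail: "norm (x m - x k) + M m / (1 - s) \<le> M k / (1 - s)" if "K \<le> k" "k \<le> m" for k m
    using that(2)
  proof (induction m rule: dec_induct)
    case (step m)
    have m: "N \<le> m" "K \<le> m" using step that NK by auto
    show ?case
      using contr'[OF m(1) lin[OF m(2)]] pot[OF m(1), of "x k"] step.IH by linarith
  qed simp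
  have dist: "norm (xbar - x k) \<le> M k / (1 - s)" if "K \<le> k" for k
  proof (rule LIMSEQ_le_const2)
    show "(\<lambda>j. norm (x (r j) - x k)) \<longlonglongrightarrow> norm (xbar - x k)"
      using xr by (auto simp: o_def intro!: tendsto_intros)
    have "norm (x (r n) - x k) \<le> M k / (1 - s)" if n: "k \<le> n" for n
    proof -
      have rn: "k \<le> r n" using n seq_suble[OF r, of n] by simp
      then have "0 \<le> M (r n) / (1 - s)" using M0[of "r n"] \<open>K \<le> k\<close> NK s by simp
      then show ?thesis using tail[OF \<open>K \<le> k\<close> rn] by linarith
    qed
    then show "\<exists>n0. \<forall>n\<ge>n0. norm (x (r n) - x k) \<le> M k / (1 - s)" by blast
  qed
  \<comment> \<open>The summand 1 keeps \<open>\<rho>0\<close> positive when the gap at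
    \<open>K\<close> is zero.\<close>
  define \<rho>0 where "\<rho>0 = M K / s ^ K / (1 - s) + 1"
  show ?thesis
  proof (rule that[OF NK lin _ s(1,2)])
    show "\<rho>0 > 0" using M0[OF NK] s by (auto simp: \<rho>0_def intro!: add_nonneg_pos)
    fix k assume k: "K \<le> k"
    have "norm (x k - xbar) \<le> M k / (1 - s)"
      using dist[OF k] by (simp add: norm_minus_commute)
    also have "\<dots> \<le> (M K / s ^ K * s ^ k) / (1 - s)"
      using Mgeo[OF k] s by (intro divide_right_mono) auto
    also have "\<dots> \<le> \<rho>0 * s ^ k"
      using s by (simp add: \<rho>0_def algebra_simps)
    finally show "norm (x k - xbar) \<le> \<rho>0 * s ^ k" .
  qed
qed

text \<open>Convexity of \<open>C\<close> and its inclusion in \<open>edom f\<close> give the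
  quadratic bound, closedness puts \<open>xbar\<close> in \<open>C\<close>, the bound
  \<open>Fmin\<close> makes the values converge, and continuity of \<open>g\<close> gives the limit
  \<open>F xbar\<close> along the subsequence.\<close>

theorem theorem3p4:
  fixes f g F :: "real ^ 'n \<Rightarrow> ereal"
    and C :: "(real ^ 'n) set"
    and L \<gamma> Fmin :: real
    and x :: "nat \<Rightarrow> real ^ 'n"
    and xbar :: "real ^ 'n"
  assumes F_def: "F = (\<lambda>y. f y + g y)"
    and f_proper: "proper_fun f" and f_lsc: "lsc_fun f"
    and g_proper: "proper_fun g" and g_lsc: "lsc_fun g"
    and f_dom_open: "open (edom f)" and f_smooth: "smooth_on_edom f"
    and C_closed: "closed C" and C_convex: "convex C"
    and C_dom: "C \<subseteq> edom f" and dom_C: "edom f \<inter> edom g \<subseteq> C"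
    and L_pos: "L > 0" and grad_lipschitz: "L-lipschitz_on C (gradient f)"
    and g_cont: "continuous_on (edom g) g"
    and F_bounded: "\<And>y. F y \<ge> ereal Fmin"
    and g_prox_bounded: "prox_bounded g"
    and step_pos: "\<gamma> > 0" and step_bound: "\<gamma> < 1 / L"
    and pg: "pg_sequence f g \<gamma> x"
    and acc: "accumulation_point x xbar"
  shows "xbar \<in> prox_stationary f g \<and>
    (pg_error_bound f g x xbar \<and> proper_separation f g xbar \<longrightarrow>
      (\<exists>k0>0.
         (\<exists>\<sigma>. 0 < \<sigma> \<and> \<sigma> < 1 \<and>
            (\<forall>k\<ge>k0. F (x (Suc k)) - F xbar \<le> ereal \<sigma> * (F (x k) - F xbar))) \<and>
         (\<exists>\<rho>0>0. \<exists>\<rho>. 0 < \<rho> \<and> \<rho> < 1 \<and>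
            (\<forall>k\<ge>k0. norm (x k - xbar) \<le> \<rho>0 * \<rho> ^ k))))"
proof -

  \<comment> \<open>Real-valued versions on the domains\<close>
  define G where "G = gradient f"
  define fr where "fr z = real_of_ereal (f z)" for z
  define gr where "gr z = real_of_ereal (g z)" for z
  define \<Phi> where "\<Phi> k = fr (x k) + gr (x k)" for k
  define a where "a = 1 / (2 * \<gamma>) - L / 2"
  have a: "a > 0" using step_pos step_bound L_pos by (simp add: a_def field_simps)
  have f_eq: "f z = ereal (fr z)" if "z \<in> edom f" for z
    unfolding fr_def by (rule proper_fun_real[OF f_proper that])
  have g_eq: "g z = ereal (gr z)" if "z \<in> edom g" for z
    unfolding gr_def by (rule proper_fun_real[OF g_proper that])
  have F_eq: "F z = ereal (fr z + gr z)" if "z \<in> edom f" "z \<in> edom g" for z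
    using f_eq[OF that(1)] g_eq[OF that(2)] by (simp add: F_def)
  have xprox: "x (Suc k) \<in> prox g \<gamma> (x k - \<gamma> *\<^sub>R G (x k))" for k
    using pg by (simp add: pg_sequence_def G_def)
  have xf: "x k \<in> edom f" for k using pg by (simp add: pg_sequence_def)
  \<comment> \<open>The starting point may lie outside \<open>edom g\<close>, so descent is only available from index 1 on.\<close>
  have xg: "x k \<in> edom g" if "1 \<le> k" for k
    using prox_in_edom[OF g_proper xprox[of "k - 1"]] that by simp
  have xC: "x k \<in> C" if "1 \<le> k" for k using xf xg[OF that] dom_C by blast
  have fder: "GDERIV fr z :> G z" if "z \<in> C" for z
    using gradient_GDERIV[OF f_smooth, of z] that C_dom by (auto simp: G_def fr_def[abs_def])
  have G_lip: "L-lipschitz_on C G" using grad_lipschitz by (simp add: G_def)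
  have f_upper: "fr v \<le> fr u + G u \<bullet> (v - u) + L / 2 * (norm (v - u))\<^sup>2"
    if "u \<in> C" "v \<in> C" for u v
    using C_convex fder G_lip that by (rule quadratic_upper_bound)
  note step = prox_gradient_step_le[OF g_proper step_pos xprox]

  \<comment> \<open>Sufficient decrease and vanishing steps\<close>
  have desc: "\<Phi> (Suc k) + a * (norm (x (Suc k) - x k))\<^sup>2 \<le> \<Phi> k" if k: "1 \<le> k" for k
    \<comment> \<open>With competitor \<open>x k\<close>, the linear term of the proximal inequality
      cancels against that of the quadratic bound for \<open>f\<close>.\<close>
    using step[of k "x k"] f_upper[OF xC[OF k] xC, of "Suc k"] g_eq[OF xg[OF k]] g_eq[OF xg, of "Suc k"]
    by (simp add: \<Phi>_def a_def inner_diff_right algebra_simps)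

  have "decseq (\<lambda>k. \<Phi> (Suc k))"
  proof (rule decseq_SucI)
    fix k
    have "0 \<le> a * (norm (x (Suc (Suc k)) - x (Suc k)))\<^sup>2" using a by simp
    then show "\<Phi> (Suc (Suc k)) \<le> \<Phi> (Suc k)" using desc[of "Suc k"] by simp
  qed
  moreover have "Fmin \<le> \<Phi> (Suc k)" for k
    using F_bounded[of "x (Suc k)"] F_eq[OF xf xg, of "Suc k"] by (simp add: \<Phi>_def)
  ultimately obtain \<zeta> where \<zeta>: "(\<lambda>k. \<Phi> (Suc k)) \<longlonglongrightarrow> \<zeta>"
    using decseq_convergent by blast
  have d0: "(\<lambda>k. norm (x (Suc k) - x k)) \<longlonglongrightarrow> 0"
  proof (rule LIMSEQ_imp_Suc)
    \<comment> \<open>Consecutive values share the limit \<open>\<zeta>\<close>, and the root of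
      their difference over \<open>a\<close> dominates the step.\<close>
    have "(\<lambda>k. sqrt ((\<Phi> (Suc k) - \<Phi> (Suc (Suc k))) / a)) \<longlonglongrightarrow> sqrt ((\<zeta> - \<zeta>) / a)"
      using \<zeta> LIMSEQ_Suc[OF \<zeta>] a by (intro tendsto_intros) auto
    then have lim: "(\<lambda>k. sqrt ((\<Phi> (Suc k) - \<Phi> (Suc (Suc k))) / a)) \<longlonglongrightarrow> 0" by simp
    have "norm (x (Suc (Suc k)) - x (Suc k)) \<le> sqrt ((\<Phi> (Suc k) - \<Phi> (Suc (Suc k))) / a)" for k
      using desc[of "Suc k"] a by (intro real_le_rsqrt) (simp add: field_simps)
    then show "(\<lambda>k. norm (x (Suc (Suc k)) - x (Suc k))) \<longlonglongrightarrow> 0"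
      by (intro tendsto_sandwich[OF _ _ tendsto_const lim]) auto
  qed

  \<comment> \<open>Stationarity of the accumulation point\<close>
  obtain r0 :: "nat \<Rightarrow> nat" where r0: "strict_mono r0" "(x \<circ> r0) \<longlonglongrightarrow> xbar"
    using acc by (auto simp: accumulation_point_def)
  \<comment> \<open>The shift makes every index at least 1, where the iterates lie in
    \<open>C\<close> and in \<open>edom g\<close>.\<close>
  define r where "r j = r0 (Suc j)" for j
  have r: "strict_mono r" using r0(1) by (simp add: r_def strict_mono_def)
  have r1: "1 \<le> r j" for j using seq_suble[OF r0(1), of "Suc j"] by (simp add: r_def)
  have xr: "(\<lambda>j. x (r j)) \<longlonglongrightarrow> xbar" using LIMSEQ_Suc[OF r0(2)] by (simp add: r_def o_def)
  have "(\<lambda>j. x (Suc (r j)) - x (r j)) \<longlonglongrightarrow> 0"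
    using LIMSEQ_subseq_LIMSEQ[OF d0 r] by (simp add: o_def tendsto_norm_zero_iff)
  from tendsto_add[OF this xr] have xr': "(\<lambda>j. x (Suc (r j))) \<longlonglongrightarrow> xbar" by simp

  have xbarC: "xbar \<in> C" using closed_sequentially[OF C_closed _ xr] xC r1 by blast
  have xbarf: "xbar \<in> edom f" using xbarC C_dom by blast
  have Gr: "(\<lambda>j. G (x (r j))) \<longlonglongrightarrow> G xbar"
    using continuous_on_tendsto_compose[OF lipschitz_on_continuous_on[OF G_lip] xr xbarC] xC r1 by simp
  have fixed: "g xbar \<le> g y + ereal (G xbar \<bullet> (y - xbar) + (norm (y - xbar))\<^sup>2 / (2 * \<gamma>))" for y
  proof (cases "y \<in> edom g")
    case False
    then show ?thesis by (simp add: edom_def)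
  next
    case True
    let ?b = "\<lambda>j. ereal (gr y + (G (x (r j)) \<bullet> (y - x (Suc (r j))) +
      ((norm (y - x (r j)))\<^sup>2 - (norm (x (Suc (r j)) - x (r j)))\<^sup>2) / (2 * \<gamma>)))"
    have "?b \<longlonglongrightarrow> ereal (gr y + (G xbar \<bullet> (y - xbar) +
        ((norm (y - xbar))\<^sup>2 - (norm (xbar - xbar))\<^sup>2) / (2 * \<gamma>)))"
      using step_pos by (intro tendsto_intros Gr xr xr') auto
    then have "g xbar \<le> ereal (gr y + (G xbar \<bullet> (y - xbar) +
        ((norm (y - xbar))\<^sup>2 - (norm (xbar - xbar))\<^sup>2) / (2 * \<gamma>)))"
      by (rule lsc_fun_le_lim[OF g_lsc xr']) (use step[of "r _" y] g_eq[OF True] in simp)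
    then show ?thesis by (simp add: g_eq[OF True])
  qed
  \<comment> \<open>\<open>fixed\<close> was derived without assuming \<open>g xbar\<close> finite;
    comparison with any point of \<open>edom g\<close> now gives finiteness.\<close>
  have xbarg: "xbar \<in> edom g"
  proof -
    obtain y where "y \<in> edom g" using g_proper by (auto simp: proper_fun_def)
    with fixed[of y] g_eq[of y] show ?thesis by (auto simp: edom_def)
  qed
  have stat: "xbar \<in> prox_stationary f g"
    using prox_stationaryI[OF xbarf xbarg step_pos] fixed by (simp add: G_def)

  \<comment> \<open>Objective values along the subsequence\<close>
  define \<Phi>bar where "\<Phi>bar = fr xbar + gr xbar"
  have \<Phi>r: "(\<lambda>j. \<Phi> (r j)) \<longlonglongrightarrow> \<Phi>bar"
    unfolding \<Phi>_def \<Phi>bar_def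
  proof (rule tendsto_add)
    have "isCont fr xbar" using fder[OF xbarC] unfolding gderiv_def by (rule has_derivative_continuous)
    then show "(\<lambda>j. fr (x (r j))) \<longlonglongrightarrow> fr xbar" using xr by (rule isCont_tendsto_compose)
    have "(\<lambda>j. g (x (r j))) \<longlonglongrightarrow> g xbar"
      using continuous_on_tendsto_compose[OF g_cont xr xbarg] xg r1 by simp
    then show "(\<lambda>j. gr (x (r j))) \<longlonglongrightarrow> gr xbar"
      using xg r1 by (simp add: g_eq xbarg)
  qed

  \<comment> \<open>Linear rate from the error bound and the separation of values\<close>
  have "\<exists>k0>0.
         (\<exists>\<sigma>. 0 < \<sigma> \<and> \<sigma> < 1 \<and>
            (\<forall>k\<ge>k0. F (x (Suc k)) - F xbar \<le> ereal \<sigma> * (F (x k) - F xbar))) \<and>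
         (\<exists>\<rho>0>0. \<exists>\<rho>. 0 < \<rho> \<and> \<rho> < 1 \<and>
            (\<forall>k\<ge>k0. norm (x k - xbar) \<le> \<rho>0 * \<rho> ^ k))"
    if eb: "pg_error_bound f g x xbar" and sep: "proper_separation f g xbar"
  proof -
    obtain \<kappa> \<epsilon> where \<kappa>: "\<kappa> > 0" and \<epsilon>: "\<epsilon> > 0" and
      eb: "\<And>k. x (Suc k) \<in> ball xbar \<epsilon> \<Longrightarrow>
        infdist (x (Suc k)) (prox_stationary f g) \<le> \<kappa> * norm (x (Suc k) - x k)"
      using eb by (auto simp: pg_error_bound_def)
    obtain \<epsilon>' where \<epsilon>': "\<epsilon>' > 0" and
      sep: "\<And>z. z \<in> prox_stationary f g \<Longrightarrow> z \<in> ball xbar \<epsilon>' \<Longrightarrow> F z = F xbar"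
      using sep by (auto simp: proper_separation_def F_def)
    \<comment> \<open>The summands come from \<open>b1\<close>, \<open>b2\<close> and
      \<open>b3\<close> below, where the chosen stationary point is within
      \<open>(\<kappa> + 1) * d\<close> of \<open>x (Suc k)\<close> and
      \<open>(\<kappa> + 2) * d\<close> of \<open>x k\<close>.\<close>
    define c where "c = L * (\<kappa> + 2) * (\<kappa> + 1) + L / 2 * (\<kappa> + 1)\<^sup>2 + (\<kappa> + 2)\<^sup>2 / (2 * \<gamma>)"
    have c: "c > 0" using L_pos \<kappa> step_pos unfolding c_def
      by (intro add_pos_pos mult_pos_pos divide_pos_pos) auto
    \<comment> \<open>Solving \<open>a * new \<le> c * (old - new)\<close> for the new gap gives
      this factor.\<close>
    define \<sigma> where "\<sigma> = c / (c + a)"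
    have \<sigma>: "0 < \<sigma>" "\<sigma> < 1" using c a by (auto simp: \<sigma>_def)
    \<comment> \<open>The other half of \<open>\<epsilon>'\<close> is left for the distance from
      \<open>x (Suc k)\<close> to the stationary point, which \<open>N0\<close> keeps below
      \<open>\<epsilon>' / 2\<close>.\<close>
    define \<delta> where "\<delta> = min \<epsilon> (\<epsilon>' / 2)"
    have \<delta>: "\<delta> > 0" using \<epsilon> \<epsilon>' by (simp add: \<delta>_def)
    have "eventually (\<lambda>k. norm (x (Suc k) - x k) < \<epsilon>' / (2 * (\<kappa> + 1))) sequentially"
      using d0 \<kappa> \<epsilon>' by (intro order_tendstoD) auto
    then obtain N0 where N0: "\<And>k. N0 \<le> k \<Longrightarrow> norm (x (Suc k) - x k) < \<epsilon>' / (2 * (\<kappa> + 1))"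
      by (auto simp: eventually_sequentially)
    define N where "N = max N0 1"

    have loc: "\<Phi> (Suc k) - \<Phi>bar \<le> \<sigma> * (\<Phi> k - \<Phi>bar)"
      if Nk: "N \<le> k" and ball: "x (Suc k) \<in> ball xbar \<delta>" for k
    proof -
      have k1: "1 \<le> k" using Nk by (simp add: N_def)
      define d where "d = norm (x (Suc k) - x k)"
      \<comment> \<open>The infimum in \<open>infdist\<close> need not be attained; enlarging
        \<open>\<kappa>\<close> to \<open>\<kappa> + 1\<close> leaves room when
        \<open>d > 0\<close>. When \<open>d = 0\<close>, the iterate is a fixed point of the step
        and is itself stationary.\<close>
      have "\<exists>z\<in>prox_stationary f g. norm (x (Suc k) - z) \<le> (\<kappa> + 1) * d"
      proof (cases "d = 0")
        case True
        then have eq: "x (Suc k) = x k" by (simp add: d_def)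
        have "x k \<in> prox_stationary f g"
          using prox_stationaryI[OF xf xg[OF k1] step_pos] step[of k] eq by (simp add: G_def)
        then show ?thesis using eq True by (intro bexI[of _ "x k"]) auto
      next
        case False
        then have "d > 0" by (simp add: d_def)
        have "infdist (x (Suc k)) (prox_stationary f g) \<le> \<kappa> * d"
          using eb[of k] ball by (simp add: \<delta>_def d_def)
        also have "\<dots> < (\<kappa> + 1) * d" using \<open>d > 0\<close> by simp
        \<comment> \<open>\<open>stat\<close> makes the stationary set nonempty, so
          \<open>infdist\<close> is a true infimum and not its default value 0.\<close>
        finally have "(INF z\<in>prox_stationary f g. dist (x (Suc k)) z) < (\<kappa> + 1) * d"
          using stat by (auto simp: infdist_def split: if_splits)
        then obtain z where "z \<in> prox_stationary f g" "dist (x (Suc k)) z < (\<kappa> + 1) * d"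
          using stat by (subst (asm) cINF_less_iff) (auto intro: bdd_belowI2[where m = 0])
        then show ?thesis by (intro bexI[of _ z]) (auto simp: dist_norm)
      qed
      then obtain z where z: "z \<in> prox_stationary f g" and zd: "norm (x (Suc k) - z) \<le> (\<kappa> + 1) * d"
        by blast
      have zf: "z \<in> edom f" and zg: "z \<in> edom g"
        using z by (auto simp: prox_stationary_def prox_subdiff_def)
      then have zC: "z \<in> C" using dom_C by blast
      have "(\<kappa> + 1) * d < \<epsilon>' / 2"
        using N0[of k] Nk \<kappa> by (simp add: N_def d_def field_simps)
      then have "z \<in> ball xbar \<epsilon>'"
        using ball zd dist_triangle[of xbar z "x (Suc k)"] by (simp add: \<delta>_def dist_norm)
      then have Fz: "fr z + gr z = \<Phi>bar"
        using sep[OF z] F_eq[OF zf zg] F_eq[OF xbarf xbarg] by (simp add: \<Phi>bar_def)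
      have zxk: "norm (z - x k) \<le> (\<kappa> + 2) * d"
        using norm_triangle_ineq[of "z - x (Suc k)" "x (Suc k) - x k"] zd
        by (simp add: d_def norm_minus_commute algebra_simps)
      have "(G z - G (x k)) \<bullet> (x (Suc k) - z) \<le> norm (G z - G (x k)) * norm (x (Suc k) - z)"
        by (rule norm_cauchy_schwarz)
      also have "\<dots> \<le> (L * norm (z - x k)) * norm (x (Suc k) - z)"
        using lipschitz_onD[OF G_lip zC xC[OF k1]] by (intro mult_right_mono) (auto simp: dist_norm)
      also have "\<dots> \<le> (L * ((\<kappa> + 2) * d)) * ((\<kappa> + 1) * d)"
        using zxk zd L_pos \<kappa> by (intro mult_mono) (auto simp: d_def)
      finally have b1: "(G z - G (x k)) \<bullet> (x (Suc k) - z) \<le> (L * ((\<kappa> + 2) * d)) * ((\<kappa> + 1) * d)" .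
      have b2: "L / 2 * (norm (x (Suc k) - z))\<^sup>2 \<le> L / 2 * ((\<kappa> + 1) * d)\<^sup>2"
        using zd L_pos by (intro mult_left_mono power_mono) auto
      have "(norm (z - x k))\<^sup>2 - d\<^sup>2 \<le> ((\<kappa> + 2) * d)\<^sup>2"
        using power_mono[OF zxk norm_ge_zero, of 2] by (intro diff_le_eq[THEN iffD2]) (simp add: add_increasing2)
      then have b3: "((norm (z - x k))\<^sup>2 - d\<^sup>2) / (2 * \<gamma>) \<le> ((\<kappa> + 2) * d)\<^sup>2 / (2 * \<gamma>)"
        using step_pos by (intro divide_right_mono) auto
      \<comment> \<open>The proximal inequality with competitor \<open>z\<close> is added to the
        quadratic bound for \<open>f\<close> from \<open>z\<close> to \<open>x (Suc k)\<close>;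
        \<open>Fz\<close> replaces the value at \<open>z\<close> by
        \<open>\<Phi>bar\<close>.\<close>
      have "\<Phi> (Suc k) - \<Phi>bar \<le> (G z - G (x k)) \<bullet> (x (Suc k) - z)
          + L / 2 * (norm (x (Suc k) - z))\<^sup>2 + ((norm (z - x k))\<^sup>2 - d\<^sup>2) / (2 * \<gamma>)"
        using step[of k z] f_upper[OF zC xC, of "Suc k"] g_eq[OF zg] g_eq[OF xg, of "Suc k"] Fz
        by (simp add: \<Phi>_def d_def inner_diff_left inner_diff_right)
      also have "\<dots> \<le> (L * ((\<kappa> + 2) * d)) * ((\<kappa> + 1) * d) + L / 2 * ((\<kappa> + 1) * d)\<^sup>2
          + ((\<kappa> + 2) * d)\<^sup>2 / (2 * \<gamma>)"
        using b1 b2 b3 by (intro add_mono)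
      also have "\<dots> = c * d\<^sup>2"
        using step_pos by (simp add: c_def field_simps power2_eq_square)
      finally have "a * (\<Phi> (Suc k) - \<Phi>bar) \<le> a * (c * d\<^sup>2)"
        using a by (intro mult_left_mono) auto
      also have "\<dots> = c * (a * d\<^sup>2)" by simp
      also have "\<dots> \<le> c * (\<Phi> k - \<Phi> (Suc k))"
        using desc[OF k1] c by (intro mult_left_mono) (auto simp: d_def)
      finally have "a * (\<Phi> (Suc k) - \<Phi>bar) \<le> c * (\<Phi> k - \<Phi> (Suc k))" .
      then show ?thesis using a c by (simp add: \<sigma>_def field_simps)
    qed
    have desc': "\<Phi> (Suc k) + a * (norm (x (Suc k) - x k))\<^sup>2 \<le> \<Phi> k" if "N \<le> k" for k
      using desc that by (simp add: N_def)
    obtain K \<rho>0 \<rho> where K: "N \<le> K" and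
      lin: "\<And>k. K \<le> k \<Longrightarrow> \<Phi> (Suc k) - \<Phi>bar \<le> \<sigma> * (\<Phi> k - \<Phi>bar)" and
      \<rho>: "\<rho>0 > 0" "0 < \<rho>" "\<rho> < 1" "\<And>k. K \<le> k \<Longrightarrow> norm (x k - xbar) \<le> \<rho>0 * \<rho> ^ k"
      using local_linear_convergence[where x = x and \<Phi> = \<Phi> and N = N,
          OF a \<delta> \<sigma> desc' r xr[folded o_def] \<Phi>r[folded o_def] loc]
      by blast
    have "F (x (Suc k)) - F xbar \<le> ereal \<sigma> * (F (x k) - F xbar)" if "K \<le> k" for k
    proof -
      have k1: "1 \<le> k" using that K by (simp add: N_def)
      show ?thesis
        using lin[OF that] F_eq[OF xf xg[OF k1]] F_eq[OF xf xg, of "Suc k"] F_eq[OF xbarf xbarg]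
        by (simp add: \<Phi>_def \<Phi>bar_def)
    qed
    moreover have "K > 0" using K by (simp add: N_def)
    ultimately show ?thesis using \<sigma> \<rho> by blast
  qed
  with stat show ?thesis by blast
qed

end
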